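(* Let $m_1,m_2$ be positive integers with $m_1\le m_2$. For $i=1,2$ let $f_i:M_i\to\mathbb{R}$ be a Morse function on a closed manifold $M_i$ of dimension $m_i$. Then for a diagonal Morse function $f$ obtained from $(f_1,f_2)$ and for an integer $j$ with $0\le j<\lfloor m_1\rfloor$, we have $$\phi_{m_1+m_2-j}(f)=\sum_{j_1=0}^{j} C_{m_1-j+j_1}(f_1)\,C_{m_2-j_1}(f_2)-\sum_{j_1=0}^{j} C_{j_1}(f_1)\,C_{j-j_1}(f_2).$$
   Context: Manifolds and maps are smooth of class $C^\infty$. A singular point of a real-valued function is a critical point. The index of a singular point $p$ of a Morse function is the usual Morse index, i.e. the number of negative squares in the local quadratic normal form at $p$, respecting the orientation of the target $\mathbb{R}$. For an integer $a$, and more generally a number $a$, $\lfloor a\rfloor$ is the maximal integer not larger than $a$. For a closed manifold $M$ of dimension $m\ge 1$ and a Morse function $g$ on $M$, $C_j(g)$ denotes the number of singular points of $g$ of index $j$, and $\phi_j(g):=C_j(g)-C_{m-j}(g)$. Diagonal Morse function: given Morse functions $f_i:M_i\to\mathbb{R}$ on closed manifolds $M_i$ of positive dimension ($i=1,2$), let $F:M_1\times M_2\to\mathbb{R}^2$ be the product map $f_1\times f_2$, $(p_1,p_2)\mapsto(f_1(p_1),f_2(p_2))$, or the composition of this product map with an affine transformation of the plane. Let $f$ be the map obtained by composing $F$ with the projection of the plane to the straight line including the diagonal $\{(t,t)\}$, which is canonically oriented and regarded as $\mathbb{R}$. A Morse function $f$ obtained from $f_1$ and $f_2$ by this procedure is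 called a diagonal Morse function obtained from $(f_1,f_2)$.
   Formalization: The affine transformation of the plane is required to make the projection to the oriented diagonal strictly increasing in each of the two coordinates; for arbitrary affine transformations (e.g. the point reflection) the formula is false. *)

theory Defs
  imports "HOL-Analysis.Analysis"
begin

section \<open>Smooth maps between Euclidean spaces\<close>

primrec C_times_diff_on ::
  "nat \<Rightarrow> 'a::euclidean_space set \<Rightarrow> ('a \<Rightarrow> 'b::real_normed_vector) \<Rightarrow> bool"
where
  "C_times_diff_on 0 S g \<longleftrightarrow> continuous_on S g"
| "C_times_diff_on (Suc n) S g \<longleftrightarrow>
     (\<forall>x\<in>S. g differentiable (at x)) \<and>
     (\<forall>v. C_times_diff_on n S (\<lambda>x. frechet_derivative g (at x) v))"

text \<open>Meaningful for open \<open>S\<close>, the only case used below.\<close>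

definition smooth_on :: "'a::euclidean_space set \<Rightarrow> ('a \<Rightarrow> 'b::real_normed_vector) \<Rightarrow> bool" where
  "smooth_on S g \<longleftrightarrow> (\<forall>n. C_times_diff_on n S g)"


section \<open>Smooth manifolds without boundary\<close>

text \<open>A chart is a pair of a domain and a coordinate map; values of the coordinate map outside
  the domain carry no meaning. The model space is a Euclidean space given as a type, so that the
  dimension of the manifold is the dimension of that type.\<close>

type_synonym ('a, 'e) chart = "'a set \<times> ('a \<Rightarrow> 'e)"

record ('a, 'e) manifold =
  mtop :: "'a topology"
  atlas :: "('a, 'e) chart set"

definition mdim :: "('a, 'e::euclidean_space) manifold \<Rightarrow> nat" where
  "mdim M = DIM('e)"

definition topological_chart :: "'a topology \<Rightarrow> ('a, 'e::euclidean_space) chart \<Rightarrow> bool" where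
  "topological_chart X = (\<lambda>(U, \<phi>).
     openin X U \<and> open (\<phi> ` U) \<and>
     homeomorphic_map (subtopology X U) (top_of_set (\<phi> ` U)) \<phi>)"

definition smoothly_compatible ::
  "('a, 'e::euclidean_space) chart \<Rightarrow> ('a, 'e) chart \<Rightarrow> bool" where
  "smoothly_compatible = (\<lambda>(U, \<phi>) (V, \<psi>).
     smooth_on (\<phi> ` (U \<inter> V)) (\<psi> \<circ> inv_into U \<phi>) \<and>
     smooth_on (\<psi> ` (U \<inter> V)) (\<phi> \<circ> inv_into V \<psi>))"

definition smooth_manifold :: "('a, 'e::euclidean_space) manifold \<Rightarrow> bool" where
  "smooth_manifold M \<longleftrightarrow>
     Hausdorff_space (mtop M) \<and> second_countable (mtop M) \<and>
     (\<forall>c\<in>atlas M. topological_chart (mtop M) c) \<and>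
     (\<Union>(U, \<phi>)\<in>atlas M. U) = topspace (mtop M) \<and>
     (\<forall>c\<in>atlas M. \<forall>d\<in>atlas M. smoothly_compatible c d)"

definition closed_manifold :: "('a, 'e::euclidean_space) manifold \<Rightarrow> bool" where
  "closed_manifold M \<longleftrightarrow> smooth_manifold M \<and> compact_space (mtop M)"

text \<open>The atlas of a manifold need not be maximal; the following are the members of the maximal
  atlas, i.e. all local coordinates of the smooth structure.\<close>

definition smooth_chart :: "('a, 'e::euclidean_space) manifold \<Rightarrow> ('a, 'e) chart \<Rightarrow> bool" where
  "smooth_chart M c \<longleftrightarrow>
     topological_chart (mtop M) c \<and> (\<forall>d\<in>atlas M. smoothly_compatible c d)"

definition prod_manifold ::
  "('a, 'e::euclidean_space) manifold \<Rightarrow> ('b, 'f::euclidean_space) manifold \<Rightarrow>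
   ('a \<times> 'b, 'e \<times> 'f) manifold" where
  "prod_manifold M N =
     \<lparr> mtop = prod_topology (mtop M) (mtop N),
       atlas = {(U \<times> V, map_prod \<phi> \<psi>) | U \<phi> V \<psi>. (U, \<phi>) \<in> atlas M \<and> (V, \<psi>) \<in> atlas N} \<rparr>"


section \<open>Morse functions\<close>

definition smooth_function :: "('a, 'e::euclidean_space) manifold \<Rightarrow> ('a \<Rightarrow> real) \<Rightarrow> bool" where
  "smooth_function M g \<longleftrightarrow> (\<forall>(U, \<phi>)\<in>atlas M. smooth_on (\<phi> ` U) (g \<circ> inv_into U \<phi>))"

definition singular_point ::
  "('a, 'e::euclidean_space) manifold \<Rightarrow> ('a \<Rightarrow> real) \<Rightarrow> 'a \<Rightarrow> bool" where
  "singular_point M g p \<longleftrightarrow>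
     (\<exists>(U, \<phi>)\<in>atlas M. p \<in> U \<and>
        ((g \<circ> inv_into U \<phi>) has_derivative (\<lambda>_. 0)) (at (\<phi> p)))"

text \<open>In suitable local coordinates around \<open>p\<close>, with \<open>p\<close> at the origin, \<open>g\<close> is \<open>g p\<close> minus
  \<open>k\<close> squares of coordinates plus the squares of the other coordinates. The set \<open>B\<close> of
  negative coordinate directions is not required to be an initial segment in some enumeration of
  the basis.\<close>

definition quadratic_normal_form ::
  "('a, 'e::euclidean_space) manifold \<Rightarrow> ('a \<Rightarrow> real) \<Rightarrow> 'a \<Rightarrow> nat \<Rightarrow> bool" where
  "quadratic_normal_form M g p k \<longleftrightarrow>
     (\<exists>U \<phi> B. smooth_chart M (U, \<phi>) \<and> p \<in> U \<and> \<phi> p = 0 \<and>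
        B \<subseteq> Basis \<and> card B = k \<and>
        (\<forall>q\<in>U. g q = g p - (\<Sum>b\<in>B. (\<phi> q \<bullet> b)\<^sup>2) + (\<Sum>b\<in>Basis - B. (\<phi> q \<bullet> b)\<^sup>2)))"

definition Morse_function :: "('a, 'e::euclidean_space) manifold \<Rightarrow> ('a \<Rightarrow> real) \<Rightarrow> bool" where
  "Morse_function M g \<longleftrightarrow>
     smooth_function M g \<and> (\<forall>p. singular_point M g p \<longrightarrow> (\<exists>k. quadratic_normal_form M g p k))"

text \<open>At a singular point of a Morse function the number \<open>k\<close> is unique by Sylvester's law of
  inertia.\<close>

definition Morse_index ::
  "('a, 'e::euclidean_space) manifold \<Rightarrow> ('a \<Rightarrow> real) \<Rightarrow> 'a \<Rightarrow> nat" where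
  "Morse_index M g p = (THE k. quadratic_normal_form M g p k)"

text \<open>The index argument is an integer, so that no truncated subtraction occurs; the count is
  zero for a negative index and for an index above the dimension.\<close>

definition C_count :: "('a, 'e::euclidean_space) manifold \<Rightarrow> int \<Rightarrow> ('a \<Rightarrow> real) \<Rightarrow> int" where
  "C_count M j g = int (card {p. singular_point M g p \<and> int (Morse_index M g p) = j})"

definition \<phi>_diff :: "('a, 'e::euclidean_space) manifold \<Rightarrow> int \<Rightarrow> ('a \<Rightarrow> real) \<Rightarrow> int" where
  "\<phi>_diff M j g = C_count M j g - C_count M (int (mdim M) - j) g"


section \<open>Diagonal Morse functions\<close>

definition affine_transformation :: "(real \<times> real \<Rightarrow> real \<times> real) \<Rightarrow> bool" where
  "affine_transformation T \<longleftrightarrow> (\<exists>L c. linear L \<and> bij L \<and> (\<forall>x. T x = L x + c))"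

text \<open>The orthogonal projection of the plane to the line \<open>{(t, t)}\<close>, this line being identified
  with the real line through its parameter \<open>t\<close>.\<close>

definition diagonal_projection :: "real \<times> real \<Rightarrow> real" where
  "diagonal_projection x = (fst x + snd x) / 2"

lemma diagonal_projection_orthogonal:
  "(x - (diagonal_projection x, diagonal_projection x)) \<bullet> (t, t) = 0"
  by (cases x) (simp add: diagonal_projection_def field_simps)

text \<open>The projection of the transformed plane to the oriented diagonal has to respect the
  orientations of both coordinate axes: with, say, the point reflection \<open>T x = - x\<close> one would get
  (a multiple of) \<open>- (f1 + f2)\<close>, whose singular points have complementary indices.\<close>

definition diagonally_oriented :: "(real \<times> real \<Rightarrow> real \<times> real) \<Rightarrow> bool" where
  "diagonally_oriented T \<longleftrightarrow>
     (\<forall>y. strict_mono (\<lambda>x. diagonal_projection (T (x, y)))) \<and>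
     (\<forall>x. strict_mono (\<lambda>y. diagonal_projection (T (x, y))))"

text \<open>The product map itself is the case \<open>T = id\<close>.\<close>

definition diagonal_Morse_function ::
  "('a, 'e::euclidean_space) manifold \<Rightarrow> ('a \<Rightarrow> real) \<Rightarrow>
   ('b, 'f::euclidean_space) manifold \<Rightarrow> ('b \<Rightarrow> real) \<Rightarrow> ('a \<times> 'b \<Rightarrow> real) \<Rightarrow> bool" where
  "diagonal_Morse_function M1 f1 M2 f2 f \<longleftrightarrow>
     Morse_function (prod_manifold M1 M2) f \<and>
     (\<exists>T. affine_transformation T \<and> diagonally_oriented T \<and>
        (\<forall>p \<in> topspace (mtop (prod_manifold M1 M2)).
           f p = diagonal_projection (T (map_prod f1 f2 p))))"

lemma affine_transformation_id: "affine_transformation id"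
  unfolding affine_transformation_def
  by (intro exI[of _ id] exI[of _ 0]) (simp add: linear_id)

lemma diagonally_oriented_id: "diagonally_oriented id"
  by (auto simp: diagonally_oriented_def diagonal_projection_def strict_mono_def)

end

theory Submission
  imports Defs
begin

text \<open>
  Up to an additive constant, a diagonal Morse function is a weighted sum
  \<open>f (p, q) = a * f1 p + b * f2 q + c\<close>; the orientation condition says exactly that both weights
  are positive. Its differential at \<open>(p, q)\<close> vanishes iff those of \<open>f1\<close> at \<open>p\<close> and \<open>f2\<close> at \<open>q\<close>
  do, so the singular points of \<open>f\<close> are the pairs of singular points
  (\<open>singular_point_iff\<close>), and at such a pair the indices add (\<open>Morse_index_add\<close>). Counting pairs
  whose indices sum to \<open>k\<close> turns \<open>C_count\<close> of \<open>f\<close> into the convolution of the counts of \<open>f1\<close> and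
  \<open>f2\<close> (\<open>C_count_convolution\<close>). In degree \<open>j\<close>, and likewise in the complementary degree
  \<open>m1 + m2 - j\<close>, with \<open>0 \<le> j < m1\<close>, all but \<open>j + 1\<close> terms of the convolution involve an index of
  \<open>f2\<close> outside \<open>{0..m2}\<close> and vanish; the surviving terms are the two sums of the theorem.

  Two points take work. The count is a cardinality, which is \<open>0\<close> for an infinite set and
  additive over finite pieces only; so one needs that a
  Morse function on a closed manifold has finitely many singular points
  (\<open>finite_singular_points\<close>). This follows from compactness, since the normal form isolates each
  singular point and the nonsingular points form an open set.

  The index is the unique number occurring in a normal form, so additivity needs a description of
  it that behaves well under products. Building a normal form of \<open>f\<close> from those of \<open>f1\<close> and \<open>f2\<close>
  would require rescaled product charts and their smoothness. Instead, the index is read off in an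
  arbitrary atlas chart from the second-order form \<open>Q w = lim (h (x + t w) - h x) / t\<^sup>2\<close> of the
  coordinate expression \<open>h\<close>. A normal form shows that \<open>Q\<close> exists and is a standard form pulled back
  by the derivative of a transition map (\<open>normal_form_second_order_form\<close>); Sylvester's argument
  shows that \<open>Q\<close> determines the index (\<open>quadratic_index_unique\<close>). For \<open>f\<close> the second-order form in a product chart is visibly
  \<open>a * Q1 v + b * Q2 w\<close>, whose index is the sum of the two indices; this agrees with the index of
  \<open>f\<close> because \<open>f\<close>, being a Morse function, has some normal form at each singular point.
\<close>

section \<open>Charts and transition maps\<close>

lemma topological_chart_inj:
  "topological_chart X (U, \<phi>) \<Longrightarrow> inj_on \<phi> U"
  unfolding topological_chart_def case_prod_conv
  by (metis homeomorphic_imp_injective_map openin_subset topspace_subtopology_subset)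

lemma topological_chart_image_open:
  assumes "topological_chart X (U, \<phi>)" "openin X W" "W \<subseteq> U"
  shows "open (\<phi> ` W)"
proof -
  have "open_map (subtopology X U) (top_of_set (\<phi> ` U)) \<phi>" "open (\<phi> ` U)" "openin X U"
    using assms(1) by (auto simp: topological_chart_def homeomorphic_eq_everything_map)
  moreover have "openin (subtopology X U) W"
    using assms(2,3) \<open>openin X U\<close> by (simp add: openin_open_subtopology)
  ultimately have "openin (top_of_set (\<phi> ` U)) (\<phi> ` W)"
    by (simp add: open_map_def)
  with \<open>open (\<phi> ` U)\<close> show ?thesis
    by (meson openin_open_trans)
qed

lemma topological_chart_preimage_open:
  assumes "topological_chart X (U, \<phi>)" "open W"
  shows "openin X {y \<in> U. \<phi> y \<in> W}"
proof -
  have U: "openin X U" and c: "continuous_map (subtopology X U) (top_of_set (\<phi> ` U)) \<phi>"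
    using assms(1) by (auto simp: topological_chart_def homeomorphic_eq_everything_map)
  have "openin (top_of_set (\<phi> ` U)) (\<phi> ` U \<inter> W)"
    using assms(2) by (simp add: openin_open_Int)
  then have "openin (subtopology X U) {y \<in> topspace (subtopology X U). \<phi> y \<in> \<phi> ` U \<inter> W}"
    using c openin_continuous_map_preimage by blast
  moreover have "{y \<in> topspace (subtopology X U). \<phi> y \<in> \<phi> ` U \<inter> W} = {y \<in> U. \<phi> y \<in> W}"
    using openin_subset[OF U] by auto
  ultimately show ?thesis
    using U by (metis openin_open_subtopology)
qed

lemma smoothly_compatible_sym: "smoothly_compatible c d \<Longrightarrow> smoothly_compatible d c"
  by (cases c; cases d) (auto simp: smoothly_compatible_def Int_commute)

lemma transition_has_derivative:
  assumes "smoothly_compatible (U, \<phi>) (V, \<psi>)" "p \<in> U \<inter> V"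
  obtains T where "((\<psi> \<circ> inv_into U \<phi>) has_derivative T) (at (\<phi> p))"
proof -
  have "C_times_diff_on (Suc 0) (\<phi> ` (U \<inter> V)) (\<psi> \<circ> inv_into U \<phi>)"
    using assms(1) by (auto simp: smoothly_compatible_def smooth_on_def)
  then have "(\<psi> \<circ> inv_into U \<phi>) differentiable (at (\<phi> p))"
    using assms(2) by auto
  then show ?thesis
    using that by (auto simp: differentiable_def)
qed

text \<open>The inverse of a chart is \<open>inv_into\<close>, so composites of coordinate expressions
  agree with the expected maps only on the image of the overlap. Every chart change below compares
  functions through this eventual equality.\<close>

lemma eventually_chart_overlap:
  assumes c: "topological_chart X (U, \<phi>)" and d: "topological_chart X (V, \<psi>)"
    and p: "p \<in> U \<inter> V"
  shows "\<forall>\<^sub>F x in nhds (\<phi> p). inv_into V \<psi> (\<psi> (inv_into U \<phi> x)) = inv_into U \<phi> x \<and>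
    \<phi> (inv_into U \<phi> x) = x \<and> inv_into U \<phi> x \<in> U \<inter> V"
proof -
  have "openin X (U \<inter> V)"
    using c d by (auto simp: topological_chart_def)
  then have "open (\<phi> ` (U \<inter> V))"
    using topological_chart_image_open[OF c] by blast
  moreover have "\<phi> p \<in> \<phi> ` (U \<inter> V)"
    using p by blast
  ultimately have "\<forall>\<^sub>F x in nhds (\<phi> p). x \<in> \<phi> ` (U \<inter> V)"
    by (rule eventually_nhds_in_open)
  then show ?thesis
  proof eventually_elim
    case (elim x)
    then show ?case
      using topological_chart_inj[OF c] topological_chart_inj[OF d]
      by (auto simp: inv_into_f_f)
  qed
qed

lemma has_derivative_cong_nhds:
  assumes "(f has_derivative D) (at x)" "\<forall>\<^sub>F y in nhds x. f y = g y"
  shows "(g has_derivative D) (at x)"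
proof (rule has_derivative_transform_eventually[OF assms(1)])
  show "\<forall>\<^sub>F y in at x. f y = g y"
    using assms(2) by (auto simp: eventually_at_filter elim: eventually_mono)
  show "f x = g x"
    using assms(2) by (rule eventually_nhds_x_imp_x)
qed simp

lemma transition_derivatives_inverse:
  assumes c: "topological_chart X (U, \<phi>)" and d: "topological_chart X (V, \<psi>)"
    and p: "p \<in> U \<inter> V"
    and T: "((\<psi> \<circ> inv_into U \<phi>) has_derivative T) (at (\<phi> p))"
    and S: "((\<phi> \<circ> inv_into V \<psi>) has_derivative S) (at (\<psi> p))"
  shows "S (T v) = v"
proof -
  have inv: "inv_into U \<phi> (\<phi> p) = p"
    using topological_chart_inj[OF c] p by simp
  have "((\<phi> \<circ> inv_into V \<psi>) \<circ> (\<psi> \<circ> inv_into U \<phi>) has_derivative S \<circ> T) (at (\<phi> p))"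
    using S T inv by (intro diff_chain_at) auto
  moreover have "\<forall>\<^sub>F x in nhds (\<phi> p). ((\<phi> \<circ> inv_into V \<psi>) \<circ> (\<psi> \<circ> inv_into U \<phi>)) x = x"
    using eventually_chart_overlap[OF c d p] by eventually_elim auto
  ultimately have "((\<lambda>x. x) has_derivative S \<circ> T) (at (\<phi> p))"
    by (rule has_derivative_cong_nhds)
  then have "S \<circ> T = (\<lambda>x. x)"
    using has_derivative_unique has_derivative_ident by blast
  then show ?thesis
    by (metis comp_apply)
qed

section \<open>Singular points\<close>

text \<open>By the chain rule, a vanishing differential does not depend on the chart. This upgrades the
  existential over charts in the definition of a singular point to a universal one.\<close>

lemma zero_derivative_chart_change:
  fixes g :: "'a \<Rightarrow> real"
  assumes c: "topological_chart X (U, \<phi>)" and d: "topological_chart X (V, \<psi>)"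
    and cd: "smoothly_compatible (U, \<phi>) (V, \<psi>)" and p: "p \<in> U \<inter> V"
    and D: "((g \<circ> inv_into V \<psi>) has_derivative (\<lambda>_. 0)) (at (\<psi> p))"
  shows "((g \<circ> inv_into U \<phi>) has_derivative (\<lambda>_. 0)) (at (\<phi> p))"
proof -
  obtain T where T: "((\<psi> \<circ> inv_into U \<phi>) has_derivative T) (at (\<phi> p))"
    using transition_has_derivative[OF cd p] .
  have inv: "inv_into U \<phi> (\<phi> p) = p"
    using topological_chart_inj[OF c] p by simp
  have "((g \<circ> inv_into V \<psi>) \<circ> (\<psi> \<circ> inv_into U \<phi>) has_derivative (\<lambda>_. 0) \<circ> T) (at (\<phi> p))"
    using D T inv by (intro diff_chain_at) auto
  moreover have "\<forall>\<^sub>F x in nhds (\<phi> p).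
      ((g \<circ> inv_into V \<psi>) \<circ> (\<psi> \<circ> inv_into U \<phi>)) x = (g \<circ> inv_into U \<phi>) x"
    using eventually_chart_overlap[OF c d p] by eventually_elim auto
  ultimately have "((g \<circ> inv_into U \<phi>) has_derivative (\<lambda>_. 0) \<circ> T) (at (\<phi> p))"
    by (rule has_derivative_cong_nhds)
  then show ?thesis
    by (simp add: o_def)
qed

lemma singular_point_in_chart:
  assumes M: "smooth_manifold M" and c: "smooth_chart M (U, \<phi>)" and p: "p \<in> U"
    and "singular_point M g p"
  shows "((g \<circ> inv_into U \<phi>) has_derivative (\<lambda>_. 0)) (at (\<phi> p))"
proof -
  obtain V \<psi> where V: "(V, \<psi>) \<in> atlas M" "p \<in> V"
    and D: "((g \<circ> inv_into V \<psi>) has_derivative (\<lambda>_. 0)) (at (\<psi> p))"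
    using assms(4) by (auto simp: singular_point_def)
  show ?thesis
    by (rule zero_derivative_chart_change[OF _ _ _ _ D])
       (use M c p V in \<open>auto simp: smooth_manifold_def smooth_chart_def\<close>)
qed

lemma atlas_smooth_chart:
  "smooth_manifold M \<Longrightarrow> c \<in> atlas M \<Longrightarrow> smooth_chart M c"
  by (simp add: smooth_manifold_def smooth_chart_def)

text \<open>In normal coordinates the gradient is \<open>2 z\<close> up to the signs of its entries, so it vanishes
  only at the origin.\<close>

lemma normal_form_isolates_singular_point:
  assumes M: "smooth_manifold M" and "quadratic_normal_form M g p k"
  obtains W where "openin (mtop M) W" "p \<in> W" "{q \<in> W. singular_point M g q} \<subseteq> {p}"
proof -
  obtain U \<phi> B where c: "smooth_chart M (U, \<phi>)" and p: "p \<in> U" "\<phi> p = 0"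
    and B: "B \<subseteq> Basis"
    and g: "\<And>q. q \<in> U \<Longrightarrow>
      g q = g p - (\<Sum>b\<in>B. (\<phi> q \<bullet> b)\<^sup>2) + (\<Sum>b\<in>Basis - B. (\<phi> q \<bullet> b)\<^sup>2)"
    using assms(2) unfolding quadratic_normal_form_def by blast
  have tc: "topological_chart (mtop M) (U, \<phi>)"
    using c by (simp add: smooth_chart_def)
  have inj: "inj_on \<phi> U"
    using topological_chart_inj[OF tc] .
  have "q = p" if q: "q \<in> U" "singular_point M g q" for q
  proof -
    let ?z = "\<phi> q"
    let ?h = "\<lambda>x. g p - (\<Sum>b\<in>B. (x \<bullet> b)\<^sup>2) + (\<Sum>b\<in>Basis - B. (x \<bullet> b)\<^sup>2)"
    have "\<forall>\<^sub>F x in nhds ?z. (g \<circ> inv_into U \<phi>) x = ?h x"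
      using eventually_chart_overlap[OF tc tc, of q] q
      by (auto elim!: eventually_mono simp: g)
    with singular_point_in_chart[OF M c q] have D0: "(?h has_derivative (\<lambda>_. 0)) (at ?z)"
      by (rule has_derivative_cong_nhds)
    have sq: "((\<lambda>x. (x \<bullet> b)\<^sup>2) has_derivative (\<lambda>v. 2 * (?z \<bullet> b) * (v \<bullet> b))) (at ?z)" for b
      by (rule has_derivative_eq_rhs, rule has_derivative_power,
          rule has_derivative_inner_left, rule has_derivative_ident) (simp add: mult_ac)
    define D where "D v = 0 - (\<Sum>b\<in>B. 2 * (?z \<bullet> b) * (v \<bullet> b))
        + (\<Sum>b\<in>Basis - B. 2 * (?z \<bullet> b) * (v \<bullet> b))" for v
    have "(?h has_derivative D) (at ?z)"
      unfolding D_def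
      by (intro has_derivative_add has_derivative_diff has_derivative_sum has_derivative_const sq)
    from has_derivative_unique[OF this D0] have E: "D v = 0" for v
      by simp
    have "?z \<bullet> c = 0" if "c \<in> Basis" for c
    proof -
      have s: "(\<Sum>b\<in>A. 2 * (?z \<bullet> b) * (c \<bullet> b)) = (if c \<in> A then 2 * (?z \<bullet> c) else 0)"
        if "A \<subseteq> Basis" for A
      proof -
        have "finite A"
          using finite_subset[OF that finite_Basis] .
        have "(\<Sum>b\<in>A. 2 * (?z \<bullet> b) * (c \<bullet> b)) = (\<Sum>b\<in>A. if c = b then 2 * (?z \<bullet> b) else 0)"
          using that \<open>c \<in> Basis\<close> by (intro sum.cong) (auto simp: inner_Basis)
        then show ?thesis
          using \<open>finite A\<close> by simp
      qed
      show ?thesis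
        using E[of c] s[OF B] s[of "Basis - B"] that
        by (cases "c \<in> B") (simp_all add: D_def)
    qed
    then have "?z = 0"
      using euclidean_all_zero_iff by blast
    then show ?thesis
      using inj p q by (metis inj_onD)
  qed
  moreover have "openin (mtop M) U"
    using tc by (simp add: topological_chart_def)
  ultimately show ?thesis
    using that p(1) by auto
qed

text \<open>Some directional derivative of the coordinate expression is nonzero at the point, and it is
  continuous.\<close>

lemma nonsingular_point_neighbourhood:
  assumes M: "smooth_manifold M" and g: "smooth_function M g"
    and x: "x \<in> topspace (mtop M)" and ns: "\<not> singular_point M g x"
  obtains W where "openin (mtop M) W" "x \<in> W" "{q \<in> W. singular_point M g q} = {}"
proof -
  obtain U \<phi> where c: "(U, \<phi>) \<in> atlas M" and xU: "x \<in> U"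
    using M x unfolding smooth_manifold_def by fast
  have tc: "topological_chart (mtop M) (U, \<phi>)"
    using M c by (auto simp: smooth_manifold_def)
  let ?g = "g \<circ> inv_into U \<phi>"
  let ?D = "\<lambda>v y. frechet_derivative ?g (at y) v"
  have "C_times_diff_on (Suc 0) (\<phi> ` U) ?g"
    using g c unfolding smooth_function_def smooth_on_def by fast
  then have dif: "\<And>y. y \<in> \<phi> ` U \<Longrightarrow> ?g differentiable (at y)"
    and cont: "\<And>v. continuous_on (\<phi> ` U) (?D v)"
    by auto
  have "\<exists>v. ?D v (\<phi> x) \<noteq> 0"
  proof (rule ccontr)
    assume "\<not> ?thesis"
    then have "frechet_derivative ?g (at (\<phi> x)) = (\<lambda>_. 0)"
      by auto
    then have "(?g has_derivative (\<lambda>_. 0)) (at (\<phi> x))"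
      using dif[of "\<phi> x"] xU frechet_derivative_works by (metis imageI)
    then show False
      using ns c xU by (auto simp: singular_point_def)
  qed
  then obtain v where v: "?D v (\<phi> x) \<noteq> 0" ..
  have oU: "open (\<phi> ` U)"
    using tc by (auto simp: topological_chart_def)
  have "open (\<phi> ` U \<inter> ?D v -` (- {0}))"
    using cont oU by (intro continuous_open_preimage) auto
  then have "openin (mtop M) {y \<in> U. \<phi> y \<in> \<phi> ` U \<inter> ?D v -` (- {0})}" (is "openin _ ?W")
    by (rule topological_chart_preimage_open[OF tc])
  moreover have "\<not> singular_point M g q" if "q \<in> ?W" for q
  proof
    assume "singular_point M g q"
    then have "(?g has_derivative (\<lambda>_. 0)) (at (\<phi> q))"
      using singular_point_in_chart[OF M atlas_smooth_chart[OF M c]] that by auto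
    then have "(\<lambda>_. 0) = frechet_derivative ?g (at (\<phi> q))"
      by (rule frechet_derivative_at)
    then have "?D v (\<phi> q) = 0"
      by metis
    then show False
      using that by auto
  qed
  ultimately show ?thesis
    using that[of ?W] xU v by auto
qed

lemma finite_singular_points:
  assumes M: "closed_manifold M" and g: "Morse_function M g"
  shows "finite {p. singular_point M g p}"
proof -
  have sm: "smooth_manifold M" and cpt: "compact_space (mtop M)"
    using M by (auto simp: closed_manifold_def)
  \<comment> \<open>These sets cover the manifold, and a finite subcover bounds the singular set.\<close>
  let ?\<W> = "{W. openin (mtop M) W \<and> finite {q \<in> W. singular_point M g q}}"
  have "\<exists>W\<in>?\<W>. x \<in> W" if x: "x \<in> topspace (mtop M)" for x
  proof (cases "singular_point M g x")
    case True
    then obtain k where "quadratic_normal_form M g x k"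
      using g by (auto simp: Morse_function_def)
    then obtain W where "openin (mtop M) W" "x \<in> W" "{q \<in> W. singular_point M g q} \<subseteq> {x}"
      by (rule normal_form_isolates_singular_point[OF sm])
    then show ?thesis
      using finite_subset by (intro bexI[of _ W]) auto
  next
    case False
    moreover have "smooth_function M g"
      using g by (simp add: Morse_function_def)
    ultimately obtain W where
      "openin (mtop M) W" "x \<in> W" "{q \<in> W. singular_point M g q} = {}"
      using nonsingular_point_neighbourhood[OF sm _ x] by blast
    moreover from this have "finite {q \<in> W. singular_point M g q}"
      by (simp only: finite.emptyI)
    ultimately show ?thesis
      by blast
  qed
  then have "topspace (mtop M) \<subseteq> \<Union>?\<W>"
    by auto
  then obtain \<F> where \<F>: "finite \<F>" "\<F> \<subseteq> ?\<W>" "topspace (mtop M) \<subseteq> \<Union>\<F>"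
    using cpt unfolding compact_space_alt by (smt (verit) mem_Collect_eq)
  have "singular_point M g q \<Longrightarrow> q \<in> topspace (mtop M)" for q
    using sm by (auto simp: singular_point_def smooth_manifold_def)
  then have "{p. singular_point M g p} \<subseteq> (\<Union>W\<in>\<F>. {q \<in> W. singular_point M g q})"
    using \<F>(3) by auto
  moreover have "finite (\<Union>W\<in>\<F>. {q \<in> W. singular_point M g q})"
    using \<F> by auto
  ultimately show ?thesis
    using finite_subset by blast
qed

section \<open>The second-order form and its index\<close>

text \<open>Two complementary subspaces on which the form is definite, respectively semidefinite, pin
  down the index, and they are easy to transport along linear isomorphisms and to form products of.\<close>

definition quadratic_index :: "('e::euclidean_space \<Rightarrow> real) \<Rightarrow> nat \<Rightarrow> bool" where
  "quadratic_index Q k \<longleftrightarrow>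
     (\<exists>N P. subspace N \<and> subspace P \<and> dim N = k \<and> k + dim P = DIM('e) \<and>
        (\<forall>v\<in>N. v \<noteq> 0 \<longrightarrow> Q v < 0) \<and> (\<forall>v\<in>P. 0 \<le> Q v))"

text \<open>Sylvester's law of inertia: a negative subspace of one decomposition meets a nonnegative
  subspace of another only in the origin, so their dimensions add up to at most that of the
  space.\<close>

lemma quadratic_index_le:
  fixes Q :: "'e::euclidean_space \<Rightarrow> real"
  assumes "quadratic_index Q k" "quadratic_index Q l"
  shows "k \<le> l"
proof -
  obtain N where N: "subspace N" "dim N = k" "\<And>v. v \<in> N \<Longrightarrow> v \<noteq> 0 \<Longrightarrow> Q v < 0"
    using assms(1) by (auto simp: quadratic_index_def)
  obtain P where P: "subspace P" "l + dim P = DIM('e)" "\<And>v. v \<in> P \<Longrightarrow> 0 \<le> Q v"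
    using assms(2) by (auto simp: quadratic_index_def)
  have "N \<inter> P \<subseteq> {0}"
    using N(3) P(3) by force
  then have "dim (N \<inter> P) = 0"
    by (simp add: dim_eq_0)
  moreover have "dim {x + y |x y. x \<in> N \<and> y \<in> P} \<le> DIM('e)"
    by (rule dim_subset_UNIV)
  ultimately have "k + dim P \<le> DIM('e)"
    using dim_sums_Int[OF N(1) P(1)] N(2) by linarith
  then show ?thesis
    using P(2) by linarith
qed

lemma quadratic_index_unique:
  "quadratic_index Q k \<Longrightarrow> quadratic_index Q l \<Longrightarrow> k = l"
  by (simp add: quadratic_index_le le_antisym)

text \<open>A nonzero vector of \<open>N1 \<times> N2\<close> may have a zero component, and the index only says that
  \<open>Q1\<close> and \<open>Q2\<close> are nonnegative at the origin; hence the assumptions on their values there.\<close>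

lemma quadratic_index_sum:
  fixes Q1 :: "'e::euclidean_space \<Rightarrow> real" and Q2 :: "'f::euclidean_space \<Rightarrow> real"
  assumes "quadratic_index Q1 k1" "quadratic_index Q2 k2" "0 < a" "0 < b"
    and "Q1 0 = 0" "Q2 0 = 0"
  shows "quadratic_index (\<lambda>(v, w). a * Q1 v + b * Q2 w) (k1 + k2)"
proof -
  obtain N1 P1 where 1: "subspace N1" "subspace P1" "dim N1 = k1" "k1 + dim P1 = DIM('e)"
    "\<And>v. v \<in> N1 \<Longrightarrow> v \<noteq> 0 \<Longrightarrow> Q1 v < 0" "\<And>v. v \<in> P1 \<Longrightarrow> 0 \<le> Q1 v"
    using assms(1) by (auto simp: quadratic_index_def)
  obtain N2 P2 where 2: "subspace N2" "subspace P2" "dim N2 = k2" "k2 + dim P2 = DIM('f)"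
    "\<And>v. v \<in> N2 \<Longrightarrow> v \<noteq> 0 \<Longrightarrow> Q2 v < 0" "\<And>v. v \<in> P2 \<Longrightarrow> 0 \<le> Q2 v"
    using assms(2) by (auto simp: quadratic_index_def)
  have neg: "a * Q1 v + b * Q2 w < 0" if "v \<in> N1" "w \<in> N2" "(v, w) \<noteq> 0" for v w
  proof -
    have "Q1 v \<le> 0" "Q2 w \<le> 0" "Q1 v < 0 \<or> Q2 w < 0"
      using 1(5)[of v] 2(5)[of w] that assms(5,6) by (auto simp: zero_prod_def less_eq_real_def)
    then show ?thesis
      using assms(3,4) by (metis add_neg_nonpos add_nonpos_neg mult_pos_neg mult_nonneg_nonpos less_imp_le)
  qed
  show ?thesis
    unfolding quadratic_index_def
  proof (intro exI conjI)
    show "subspace (N1 \<times> N2)" "subspace (P1 \<times> P2)"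
      using 1(1,2) 2(1,2) by (simp_all add: subspace_Times)
    show "dim (N1 \<times> N2) = k1 + k2"
      using 1(1,3) 2(1,3) by (simp add: dim_Times)
    show "k1 + k2 + dim (P1 \<times> P2) = DIM('e \<times> 'f)"
      using 1(2,4) 2(2,4) by (simp add: dim_Times)
    show "\<forall>v\<in>N1 \<times> N2. v \<noteq> 0 \<longrightarrow> (case v of (v, w) \<Rightarrow> a * Q1 v + b * Q2 w) < 0"
      using neg by auto
    show "\<forall>v\<in>P1 \<times> P2. 0 \<le> (case v of (v, w) \<Rightarrow> a * Q1 v + b * Q2 w)"
      using 1(6) 2(6) assms(3,4) by fastforce
  qed
qed

text \<open>At a critical point of a twice differentiable function this is half of its Hessian form. The
  definition by limits along lines makes \<open>Q\<close> unique and compatible with weighted sums.\<close>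

definition second_order_form :: "('e::euclidean_space \<Rightarrow> real) \<Rightarrow> 'e \<Rightarrow> ('e \<Rightarrow> real) \<Rightarrow> bool" where
  "second_order_form h x Q \<longleftrightarrow>
     (\<forall>w. ((\<lambda>t. (h (x + t *\<^sub>R w) - h x) / t\<^sup>2) \<longlongrightarrow> Q w) (at 0))"

lemma second_order_form_unique:
  "second_order_form h x Q \<Longrightarrow> second_order_form h x R \<Longrightarrow> Q = R"
  by (rule ext) (meson second_order_form_def LIM_unique)

lemma second_order_form_0: "second_order_form h x Q \<Longrightarrow> Q 0 = 0"
  unfolding second_order_form_def
  by (drule spec[of _ 0]) (simp add: tendsto_const_iff)

text \<open>With \<open>q\<close> the standard form of the normal chart and \<open>T\<close> the derivative of the transition
  map \<open>\<tau>\<close> into that chart, homogeneity of \<open>q\<close> gives \<open>q (\<tau> (x + t w)) / t\<^sup>2 = q (\<tau> (x + t w) / t)\<close>,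
  which tends to \<open>q (T w)\<close>. As \<open>T\<close> is invertible, the index of \<open>q \<circ> T\<close> is that of \<open>q\<close>. The
  chart \<open>(V, \<psi>)\<close> is required to be a homeomorphism onto an open set, instead of \<open>M\<close> to be a smooth
  manifold, so that the lemma applies to product charts directly.\<close>

lemma normal_form_second_order_form:
  assumes "quadratic_normal_form M g p k"
    and d: "(V, \<psi>) \<in> atlas M" and td: "topological_chart (mtop M) (V, \<psi>)" and pV: "p \<in> V"
  obtains Q where "second_order_form (g \<circ> inv_into V \<psi>) (\<psi> p) Q" "quadratic_index Q k"
proof -
  obtain U \<phi> and B :: "'b set" where c: "smooth_chart M (U, \<phi>)" and p: "p \<in> U" "\<phi> p = 0"
    and B: "B \<subseteq> Basis" "card B = k"
    and g: "\<And>q. q \<in> U \<Longrightarrow>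
      g q = g p - (\<Sum>b\<in>B. (\<phi> q \<bullet> b)\<^sup>2) + (\<Sum>b\<in>Basis - B. (\<phi> q \<bullet> b)\<^sup>2)"
    using assms(1) unfolding quadratic_normal_form_def by blast
  have tc: "topological_chart (mtop M) (U, \<phi>)" and cd: "smoothly_compatible (U, \<phi>) (V, \<psi>)"
    using c d by (auto simp: smooth_chart_def)
  have pUV: "p \<in> U \<inter> V" "p \<in> V \<inter> U"
    using p pV by auto
  have inv: "inv_into V \<psi> (\<psi> p) = p"
    using topological_chart_inj[OF td] pV by simp
  define \<tau> where "\<tau> = \<phi> \<circ> inv_into V \<psi>"
  obtain S where S: "((\<psi> \<circ> inv_into U \<phi>) has_derivative S) (at (\<phi> p))"
    using transition_has_derivative[OF cd pUV(1)] .
  obtain T where T: "(\<tau> has_derivative T) (at (\<psi> p))"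
    using transition_has_derivative[OF smoothly_compatible_sym[OF cd] pUV(2)] \<tau>_def by blast
  have ST: "S (T v) = v" "T (S v) = v" for v
    using transition_derivatives_inverse[OF td tc pUV(2) T[unfolded \<tau>_def] S]
      transition_derivatives_inverse[OF tc td pUV(1) S T[unfolded \<tau>_def]] by auto
  have linS: "linear S" and linT: "linear T"
    using S T has_derivative_linear by blast+
  define q where "q z = - (\<Sum>b\<in>B. (z \<bullet> b)\<^sup>2) + (\<Sum>b\<in>Basis - B. (z \<bullet> b)\<^sup>2)" for z :: 'b
  have \<tau>0: "\<tau> (\<psi> p) = 0"
    using inv p by (simp add: \<tau>_def)
  have gq: "\<forall>\<^sub>F x in nhds (\<psi> p). (g \<circ> inv_into V \<psi>) x = g p + q (\<tau> x)"
    using eventually_chart_overlap[OF td tc pUV(2)]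
    by eventually_elim (auto simp: g q_def \<tau>_def)
  have "second_order_form (g \<circ> inv_into V \<psi>) (\<psi> p) (q \<circ> T)"
    unfolding second_order_form_def
  proof
    fix w
    let ?l = "\<lambda>t::real. \<psi> p + t *\<^sub>R w"
    have comp: "((\<lambda>t. (\<tau> (?l t) \<bullet> b) / t) \<longlongrightarrow> T w \<bullet> b) (at 0)" for b
    proof -
      have "(?l has_derivative (\<lambda>t. t *\<^sub>R w)) (at 0)"
        by (auto intro!: derivative_eq_intros)
      moreover have "(\<tau> has_derivative T) (at (?l 0))"
        using T by simp
      ultimately have "((\<lambda>t. \<tau> (?l t)) has_derivative (\<lambda>t. T (t *\<^sub>R w))) (at 0)"
        by (rule has_derivative_compose)
      then have "((\<lambda>t. \<tau> (?l t) \<bullet> b) has_derivative (\<lambda>t. T (t *\<^sub>R w) \<bullet> b)) (at 0)"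
        by (rule has_derivative_inner_left)
      then have "((\<lambda>t. \<tau> (?l t) \<bullet> b) has_field_derivative (T w \<bullet> b)) (at 0)"
        by (simp add: has_field_derivative_def linear_cmul[OF linT] mult.commute[of _ "T w \<bullet> b"])
      then show ?thesis
        by (simp add: DERIV_def \<tau>0)
    qed
    have "((\<lambda>t. - (\<Sum>b\<in>B. ((\<tau> (?l t) \<bullet> b) / t)\<^sup>2) + (\<Sum>b\<in>Basis - B. ((\<tau> (?l t) \<bullet> b) / t)\<^sup>2))
        \<longlongrightarrow> q (T w)) (at 0)"
      unfolding q_def by (intro tendsto_intros comp)
    then have "((\<lambda>t. q (\<tau> (?l t)) / t\<^sup>2) \<longlongrightarrow> q (T w)) (at 0)"
      by (simp add: q_def power_divide sum_divide_distrib add_divide_distrib diff_divide_distrib)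
    moreover have "\<forall>\<^sub>F t in at 0. q (\<tau> (?l t)) / t\<^sup>2 =
       ((g \<circ> inv_into V \<psi>) (?l t) - (g \<circ> inv_into V \<psi>) (\<psi> p)) / t\<^sup>2"
    proof -
      have "(?l \<longlongrightarrow> \<psi> p + 0 *\<^sub>R w) (at 0)"
        by (intro tendsto_intros)
      then have "filterlim ?l (nhds (\<psi> p)) (at 0)"
        by simp
      from filterlim_iff[THEN iffD1, OF this, rule_format, OF gq] show ?thesis
        by eventually_elim (simp add: inv)
    qed
    ultimately show "((\<lambda>t. ((g \<circ> inv_into V \<psi>) (?l t) - (g \<circ> inv_into V \<psi>) (\<psi> p)) / t\<^sup>2)
        \<longlongrightarrow> (q \<circ> T) w) (at 0)"
      by (simp add: tendsto_cong)
  qed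
  \<comment> \<open>The inverse derivative \<open>S\<close> carries the two coordinate subspaces of the normal chart over.\<close>
  moreover have "quadratic_index (q \<circ> T) k"
  proof -
    have injS: "inj S"
      using ST by (metis injI)
    have dimS: "dim (S ` span A) = card A" if "A \<subseteq> Basis" for A
    proof -
      have "independent A"
        using that independent_Basis independent_mono by blast
      then have "dim (span A) = card A"
        by (simp add: dim_eq_card_independent)
      moreover have "dim (S ` span A) = dim (span A)"
        using linS injS by (intro dim_image_eq) (auto intro: inj_on_subset)
      ultimately show ?thesis by simp
    qed
    have orth: "z \<bullet> b = 0" if "z \<in> span A" "A \<subseteq> Basis" "b \<in> Basis - A" for z b :: 'b and A
    proof -
      have "orthogonal b z"
        using that by (intro orthogonal_to_span[OF that(1)]) (auto simp: orthogonal_def inner_Basis)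
      then show ?thesis by (simp add: orthogonal_def inner_commute)
    qed
    have neg: "q z < 0" if z: "z \<in> span B" "z \<noteq> 0" for z
    proof -
      have "(\<Sum>b\<in>Basis - B. (z \<bullet> b)\<^sup>2) = 0"
        using orth[OF z(1) B(1)] by simp
      moreover obtain c where c: "c \<in> Basis" "z \<bullet> c \<noteq> 0"
        using z(2) euclidean_all_zero_iff by blast
      then have "c \<in> B"
        using orth[OF z(1) B(1)] by blast
      then have "0 < (\<Sum>b\<in>B. (z \<bullet> b)\<^sup>2)"
        using c B(1) by (intro sum_pos2[of B c]) (auto intro: finite_subset)
      ultimately show ?thesis by (simp add: q_def)
    qed
    have pos: "0 \<le> q z" if "z \<in> span (Basis - B)" for z
    proof -
      have "(\<Sum>b\<in>B. (z \<bullet> b)\<^sup>2) = 0"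
        using orth[OF that] B(1) by (intro sum.neutral) auto
      then show ?thesis by (simp add: q_def sum_nonneg)
    qed
    have "card B + card (Basis - B) = DIM('b)"
      using B(1) by (metis card_Diff_subset card_mono finite_Basis finite_subset le_add_diff_inverse)
    then show ?thesis
      unfolding quadratic_index_def
      using B neg pos linS ST linear_0[OF linS]
      by (intro exI[of _ "S ` span B"] exI[of _ "S ` span (Basis - B)"])
         (auto simp: dimS linear_subspace_image)
  qed
  ultimately show ?thesis
    by (rule that)
qed

text \<open>Index computation in any chart of the atlas. The existence of a normal form has to be assumed
  because otherwise \<open>Morse_index\<close> is an arbitrary number.\<close>

lemma Morse_index_eqI:
  assumes n: "quadratic_normal_form M g p k"
    and d: "(V, \<psi>) \<in> atlas M" and td: "topological_chart (mtop M) (V, \<psi>)" and pV: "p \<in> V"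
    and Q: "second_order_form (g \<circ> inv_into V \<psi>) (\<psi> p) Q" "quadratic_index Q l"
  shows "Morse_index M g p = l"
proof -
  have un: "i = l" if "quadratic_normal_form M g p i" for i
    using normal_form_second_order_form[OF that d td pV] Q
    by (metis quadratic_index_unique second_order_form_unique)
  show ?thesis
    unfolding Morse_index_def using un n by (intro the_equality) auto
qed

lemma Morse_index_le_dim:
  fixes M :: "('a, 'e::euclidean_space) manifold"
  assumes M: "smooth_manifold M" and g: "Morse_function M g" and p: "singular_point M g p"
  shows "Morse_index M g p \<le> mdim M"
proof -
  obtain V \<psi> where d: "(V, \<psi>) \<in> atlas M" "p \<in> V"
    using p by (auto simp: singular_point_def)
  have td: "topological_chart (mtop M) (V, \<psi>)"
    using M d by (auto simp: smooth_manifold_def)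
  obtain k where n: "quadratic_normal_form M g p k"
    using g p by (auto simp: Morse_function_def)
  obtain Q where Q: "second_order_form (g \<circ> inv_into V \<psi>) (\<psi> p) Q" "quadratic_index Q k"
    using normal_form_second_order_form[OF n d(1) td d(2)] .
  have "k \<le> DIM('e)"
    using Q(2) by (auto simp: quadratic_index_def)
  then show ?thesis
    using Morse_index_eqI[OF n d(1) td d(2) Q] by (simp add: mdim_def)
qed

section \<open>Weighted sums on a product manifold\<close>

text \<open>The diagonal projection of an affine transformation is an affine functional; being strictly
  increasing in each variable, it has positive coefficients.\<close>

lemma diagonal_projection_affine:
  assumes "affine_transformation T" "diagonally_oriented T"
  obtains a b c :: real where "0 < a" "0 < b"
    "\<And>x y. diagonal_projection (T (x, y)) = a * x + b * y + c"
proof -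
  obtain L d where L: "linear L" and T: "\<And>z. T z = L z + d"
    using assms(1) by (auto simp: affine_transformation_def)
  define a where "a = diagonal_projection (L (1, 0))"
  define b where "b = diagonal_projection (L (0, 1))"
  define c where "c = diagonal_projection d"
  have eq: "diagonal_projection (T (x, y)) = a * x + b * y + c" for x y
  proof -
    have "L (x, y) = L (x *\<^sub>R (1, 0) + y *\<^sub>R (0, 1))"
      by simp
    also have "\<dots> = x *\<^sub>R L (1, 0) + y *\<^sub>R L (0, 1)"
      by (simp only: linear_add[OF L] linear_cmul[OF L])
    finally show ?thesis
      by (simp add: T a_def b_def c_def diagonal_projection_def field_simps)
  qed
  have "diagonal_projection (T (0, 0)) < diagonal_projection (T (1, 0))"
    "diagonal_projection (T (0, 0)) < diagonal_projection (T (0, 1))"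
    using assms(2) unfolding diagonally_oriented_def strict_mono_def by simp_all
  then have "0 < a" "0 < b"
    by (simp_all add: eq)
  then show ?thesis
    using that eq by blast
qed

lemma topological_chart_prod:
  assumes "topological_chart X (U, \<phi>)" "topological_chart Y (V, \<psi>)"
  shows "topological_chart (prod_topology X Y) (U \<times> V, map_prod \<phi> \<psi>)"
proof -
  have im: "map_prod \<phi> \<psi> ` (U \<times> V) = \<phi> ` U \<times> \<psi> ` V"
    by (rule map_prod_image)
  obtain \<phi>' \<psi>' where
    "homeomorphic_maps (subtopology X U) (top_of_set (\<phi> ` U)) \<phi> \<phi>'"
    "homeomorphic_maps (subtopology Y V) (top_of_set (\<psi> ` V)) \<psi> \<psi>'"
    using assms by (auto simp: topological_chart_def homeomorphic_map_maps)
  then have "homeomorphic_maps (prod_topology (subtopology X U) (subtopology Y V))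
      (prod_topology (top_of_set (\<phi> ` U)) (top_of_set (\<psi> ` V)))
      (\<lambda>(x, y). (\<phi> x, \<psi> y)) (\<lambda>(x, y). (\<phi>' x, \<psi>' y))"
    by (simp add: homeomorphic_maps_prod del: prod_topology_subtopology_eu)
  then have "homeomorphic_map (subtopology (prod_topology X Y) (U \<times> V))
      (top_of_set (\<phi> ` U \<times> \<psi> ` V)) (map_prod \<phi> \<psi>)"
    unfolding subtopology_Times[symmetric] prod_topology_subtopology_eu map_prod_def
    by (auto simp: homeomorphic_map_maps)
  then show ?thesis
    using assms by (auto simp: topological_chart_def im open_Times openin_prod_Times_iff)
qed

lemma has_derivative_zero_cancel_affine:
  fixes h :: "'e::real_normed_vector \<Rightarrow> real"
  assumes "((\<lambda>x. d * h x + e) has_derivative (\<lambda>_. 0)) (at x)" "d \<noteq> 0"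
  shows "(h has_derivative (\<lambda>_. 0)) (at x)"
proof -
  have "((\<lambda>x. (1 / d) * ((d * h x + e) - e)) has_derivative (\<lambda>_. (1 / d) * (0 - 0))) (at x)"
    by (intro has_derivative_mult_right has_derivative_diff has_derivative_const assms(1))
  moreover have "(\<lambda>x. (1 / d) * ((d * h x + e) - e)) = h"
    using assms(2) by auto
  ultimately show ?thesis
    by simp
qed

text \<open>The equation for \<open>f\<close> is imposed on the points of the product only, as in the definition of a
  diagonal Morse function.\<close>

locale weighted_sum_on_product =
  fixes M1 :: "('a, 'e::euclidean_space) manifold" and f1 :: "'a \<Rightarrow> real"
    and M2 :: "('b, 'f::euclidean_space) manifold" and f2 :: "'b \<Rightarrow> real"
    and f :: "'a \<times> 'b \<Rightarrow> real" and a b c :: real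
  assumes M1: "smooth_manifold M1" and M2: "smooth_manifold M2"
    and f1: "Morse_function M1 f1" and f2: "Morse_function M2 f2"
    and f: "Morse_function (prod_manifold M1 M2) f"
    and a: "0 < a" and b: "0 < b"
    and f_eq: "\<And>p q. p \<in> topspace (mtop M1) \<Longrightarrow> q \<in> topspace (mtop M2) \<Longrightarrow>
      f (p, q) = a * f1 p + b * f2 q + c"
begin

lemma local_expression:
  assumes "(U, \<phi>) \<in> atlas M1" "p \<in> U" "(V, \<psi>) \<in> atlas M2" "q \<in> V"
  shows "\<forall>\<^sub>F z in nhds (\<phi> p, \<psi> q).
    a * (f1 \<circ> inv_into U \<phi>) (fst z) + b * (f2 \<circ> inv_into V \<psi>) (snd z) + c =
    (f \<circ> inv_into (U \<times> V) (map_prod \<phi> \<psi>)) z"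
proof -
  have t: "topological_chart (mtop M1) (U, \<phi>)" "topological_chart (mtop M2) (V, \<psi>)"
    using M1 M2 assms by (auto simp: smooth_manifold_def)
  have inj: "inj_on \<phi> U" "inj_on \<psi> V"
    using t topological_chart_inj by blast+
  have sub: "U \<subseteq> topspace (mtop M1)" "V \<subseteq> topspace (mtop M2)"
    using t by (auto simp: topological_chart_def dest: openin_subset)
  have "open (\<phi> ` U \<times> \<psi> ` V)"
    using t by (auto simp: topological_chart_def open_Times)
  then have "\<forall>\<^sub>F z in nhds (\<phi> p, \<psi> q). z \<in> \<phi> ` U \<times> \<psi> ` V"
    using assms by (intro eventually_nhds_in_open) auto
  then show ?thesis
  proof eventually_elim
    case (elim z)
    then obtain x y where z: "z = map_prod \<phi> \<psi> (x, y)" and xy: "x \<in> U" "y \<in> V"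
      by auto
    have "inj_on (map_prod \<phi> \<psi>) (U \<times> V)"
      using inj by (rule map_prod_inj_on)
    then have "inv_into (U \<times> V) (map_prod \<phi> \<psi>) z = (x, y)"
      unfolding z using xy by (intro inv_into_f_f) auto
    moreover have "f (x, y) = a * f1 x + b * f2 y + c"
      using f_eq sub xy by blast
    ultimately show ?case
      using inj xy by (simp add: z)
  qed
qed

lemma singular_point_iff:
  "singular_point (prod_manifold M1 M2) f (p, q) \<longleftrightarrow> singular_point M1 f1 p \<and> singular_point M2 f2 q"
proof
  assume "singular_point (prod_manifold M1 M2) f (p, q)"
  then obtain U \<phi> V \<psi> where c1: "(U, \<phi>) \<in> atlas M1" "p \<in> U" and c2: "(V, \<psi>) \<in> atlas M2" "q \<in> V"
    and D: "((f \<circ> inv_into (U \<times> V) (map_prod \<phi> \<psi>)) has_derivative (\<lambda>_. 0)) (at (\<phi> p, \<psi> q))"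
    by (auto simp: singular_point_def prod_manifold_def)
  let ?h = "\<lambda>z. a * (f1 \<circ> inv_into U \<phi>) (fst z) + b * (f2 \<circ> inv_into V \<psi>) (snd z) + c"
  have "\<forall>\<^sub>F z in nhds (\<phi> p, \<psi> q). (f \<circ> inv_into (U \<times> V) (map_prod \<phi> \<psi>)) z = ?h z"
    using local_expression[OF c1 c2] by (simp add: eq_commute)
  then have D': "(?h has_derivative (\<lambda>_. 0)) (at (\<phi> p, \<psi> q))"
    by (rule has_derivative_cong_nhds[OF D])
  \<comment> \<open>Restrict to the two coordinate slices through the point.\<close>
  have i1: "((\<lambda>x. (x, \<psi> q)) has_derivative (\<lambda>x. (x, 0))) (at (\<phi> p))"
    by (intro has_derivative_Pair has_derivative_ident has_derivative_const)
  have i2: "(Pair (\<phi> p) has_derivative (\<lambda>y. (0, y))) (at (\<psi> q))"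
    by (intro has_derivative_Pair has_derivative_ident has_derivative_const)
  have "((\<lambda>x. ?h (x, \<psi> q)) has_derivative (\<lambda>_. 0)) (at (\<phi> p))"
    using has_derivative_compose[OF i1 D'] .
  then have "((\<lambda>x. a * (f1 \<circ> inv_into U \<phi>) x + (b * (f2 \<circ> inv_into V \<psi>) (\<psi> q) + c))
      has_derivative (\<lambda>_. 0)) (at (\<phi> p))"
    by (simp only: fst_conv snd_conv add_ac)
  then have "((f1 \<circ> inv_into U \<phi>) has_derivative (\<lambda>_. 0)) (at (\<phi> p))"
    by (rule has_derivative_zero_cancel_affine) (use a in simp)
  moreover have "((\<lambda>y. ?h (\<phi> p, y)) has_derivative (\<lambda>_. 0)) (at (\<psi> q))"
    using has_derivative_compose[OF i2 D'] .
  then have "((\<lambda>y. b * (f2 \<circ> inv_into V \<psi>) y + (a * (f1 \<circ> inv_into U \<phi>) (\<phi> p) + c))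
      has_derivative (\<lambda>_. 0)) (at (\<psi> q))"
    by (simp only: fst_conv snd_conv add_ac)
  then have "((f2 \<circ> inv_into V \<psi>) has_derivative (\<lambda>_. 0)) (at (\<psi> q))"
    by (rule has_derivative_zero_cancel_affine) (use b in simp)
  ultimately show "singular_point M1 f1 p \<and> singular_point M2 f2 q"
    using c1 c2 by (auto simp: singular_point_def)
next
  assume "singular_point M1 f1 p \<and> singular_point M2 f2 q"
  then obtain U \<phi> V \<psi> where c1: "(U, \<phi>) \<in> atlas M1" "p \<in> U" and c2: "(V, \<psi>) \<in> atlas M2" "q \<in> V"
    and D1: "((f1 \<circ> inv_into U \<phi>) has_derivative (\<lambda>_. 0)) (at (\<phi> p))"
    and D2: "((f2 \<circ> inv_into V \<psi>) has_derivative (\<lambda>_. 0)) (at (\<psi> q))"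
    by (auto simp: singular_point_def)
  have "((\<lambda>z. (f1 \<circ> inv_into U \<phi>) (fst z)) has_derivative (\<lambda>_. 0)) (at (\<phi> p, \<psi> q))"
    by (rule has_derivative_compose[OF has_derivative_fst[OF has_derivative_ident]]) (simp only: fst_conv snd_conv D1)
  moreover have "((\<lambda>z. (f2 \<circ> inv_into V \<psi>) (snd z)) has_derivative (\<lambda>_. 0)) (at (\<phi> p, \<psi> q))"
    by (rule has_derivative_compose[OF has_derivative_snd[OF has_derivative_ident]]) (simp only: fst_conv snd_conv D2)
  ultimately have "((\<lambda>z. a * (f1 \<circ> inv_into U \<phi>) (fst z) + b * (f2 \<circ> inv_into V \<psi>) (snd z) + c)
      has_derivative (\<lambda>_. a * 0 + b * 0 + 0)) (at (\<phi> p, \<psi> q))"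
    by (intro has_derivative_add has_derivative_mult_right has_derivative_const)
  then have "((f \<circ> inv_into (U \<times> V) (map_prod \<phi> \<psi>)) has_derivative (\<lambda>_. 0)) (at (\<phi> p, \<psi> q))"
    unfolding mult_zero_right add_0_right
    by (rule has_derivative_cong_nhds[OF _ local_expression[OF c1 c2]])
  moreover have "(U \<times> V, map_prod \<phi> \<psi>) \<in> atlas (prod_manifold M1 M2)"
    using c1 c2 by (auto simp: prod_manifold_def)
  ultimately show "singular_point (prod_manifold M1 M2) f (p, q)"
    unfolding singular_point_def using c1 c2 by (intro bexI[of _ "(U \<times> V, map_prod \<phi> \<psi>)"]) auto
qed

text \<open>The second-order form of the weighted sum in a product chart is the weighted sum of the
  second-order forms, and the indices of forms in separate variables add.\<close>

lemma Morse_index_add: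
  assumes p: "singular_point M1 f1 p" and q: "singular_point M2 f2 q"
  shows "Morse_index (prod_manifold M1 M2) f (p, q) = Morse_index M1 f1 p + Morse_index M2 f2 q"
proof -
  obtain U \<phi> where c1: "(U, \<phi>) \<in> atlas M1" "p \<in> U"
    using p by (auto simp: singular_point_def)
  obtain V \<psi> where c2: "(V, \<psi>) \<in> atlas M2" "q \<in> V"
    using q by (auto simp: singular_point_def)
  have t1: "topological_chart (mtop M1) (U, \<phi>)" and t2: "topological_chart (mtop M2) (V, \<psi>)"
    using M1 M2 c1 c2 by (auto simp: smooth_manifold_def)
  obtain k1 where n1: "quadratic_normal_form M1 f1 p k1"
    using f1 p by (auto simp: Morse_function_def)
  obtain k2 where n2: "quadratic_normal_form M2 f2 q k2"
    using f2 q by (auto simp: Morse_function_def)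
  obtain k where n: "quadratic_normal_form (prod_manifold M1 M2) f (p, q) k"
    using f p q singular_point_iff[of p q] unfolding Morse_function_def by blast
  obtain Q1 where Q1: "second_order_form (f1 \<circ> inv_into U \<phi>) (\<phi> p) Q1" "quadratic_index Q1 k1"
    using normal_form_second_order_form[OF n1 c1(1) t1 c1(2)] .
  obtain Q2 where Q2: "second_order_form (f2 \<circ> inv_into V \<psi>) (\<psi> q) Q2" "quadratic_index Q2 k2"
    using normal_form_second_order_form[OF n2 c2(1) t2 c2(2)] .
  let ?F = "f \<circ> inv_into (U \<times> V) (map_prod \<phi> \<psi>)"
  let ?Q = "\<lambda>(v, w). a * Q1 v + b * Q2 w"
  have "second_order_form ?F (\<phi> p, \<psi> q) ?Q"
    unfolding second_order_form_def
  proof clarify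
    fix v w
    let ?l = "\<lambda>t::real. (\<phi> p, \<psi> q) + t *\<^sub>R (v, w)"
    let ?d1 = "\<lambda>t. (f1 \<circ> inv_into U \<phi>) (\<phi> p + t *\<^sub>R v) - (f1 \<circ> inv_into U \<phi>) (\<phi> p)"
    let ?d2 = "\<lambda>t. (f2 \<circ> inv_into V \<psi>) (\<psi> q + t *\<^sub>R w) - (f2 \<circ> inv_into V \<psi>) (\<psi> q)"
    have "((\<lambda>t. a * (?d1 t / t\<^sup>2) + b * (?d2 t / t\<^sup>2)) \<longlongrightarrow> a * Q1 v + b * Q2 w) (at 0)"
      using Q1(1) Q2(1) unfolding second_order_form_def by (intro tendsto_intros) auto
    moreover have "\<forall>\<^sub>F t in at 0.
        a * (?d1 t / t\<^sup>2) + b * (?d2 t / t\<^sup>2) = (?F (?l t) - ?F (\<phi> p, \<psi> q)) / t\<^sup>2"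
    proof -
      have "(?l \<longlongrightarrow> (\<phi> p, \<psi> q) + 0 *\<^sub>R (v, w)) (at 0)"
        by (intro tendsto_intros)
      then have "filterlim ?l (nhds (\<phi> p, \<psi> q)) (at 0)"
        by simp
      from filterlim_iff[THEN iffD1, OF this, rule_format, OF local_expression[OF c1 c2]]
      show ?thesis
      proof eventually_elim
        case (elim t)
        show ?case
          unfolding elim[symmetric] eventually_nhds_x_imp_x[OF local_expression[OF c1 c2], symmetric]
          by (simp add: diff_divide_distrib add_divide_distrib algebra_simps)
      qed
    qed
    ultimately show "((\<lambda>t. (?F (?l t) - ?F (\<phi> p, \<psi> q)) / t\<^sup>2) \<longlongrightarrow> a * Q1 v + b * Q2 w) (at 0)"
      by (simp only: tendsto_cong)
  qed
  moreover have "quadratic_index ?Q (k1 + k2)"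
    using quadratic_index_sum[OF Q1(2) Q2(2) a b second_order_form_0[OF Q1(1)]
        second_order_form_0[OF Q2(1)]] .
  moreover have "topological_chart (mtop (prod_manifold M1 M2)) (U \<times> V, map_prod \<phi> \<psi>)"
    using topological_chart_prod[OF t1 t2] by (simp add: prod_manifold_def)
  moreover have "(U \<times> V, map_prod \<phi> \<psi>) \<in> atlas (prod_manifold M1 M2)" "(p, q) \<in> U \<times> V"
    using c1 c2 by (auto simp: prod_manifold_def)
  ultimately have "Morse_index (prod_manifold M1 M2) f (p, q) = k1 + k2"
    using Morse_index_eqI[OF n] by simp
  moreover have "Morse_index M1 f1 p = k1" "Morse_index M2 f2 q = k2"
    using Morse_index_eqI[OF n1 c1(1) t1 c1(2) Q1] Morse_index_eqI[OF n2 c2(1) t2 c2(2) Q2] by auto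
  ultimately show ?thesis by simp
qed

end

section \<open>Counting singular points\<close>

lemma C_count_eq_0:
  assumes "smooth_manifold M" "Morse_function M g" "i < 0 \<or> int (mdim M) < i"
  shows "C_count M i g = 0"
proof -
  have "{p. singular_point M g p \<and> int (Morse_index M g p) = i} = {}"
    using Morse_index_le_dim[OF assms(1,2)] assms(3) by fastforce
  then show ?thesis
    by (simp only: C_count_def card.empty)
qed

text \<open>The singular points of index \<open>k\<close> are sorted by the index \<open>i\<close> of their first component.\<close>

lemma (in weighted_sum_on_product) C_count_convolution:
  assumes fin1: "finite {p. singular_point M1 f1 p}" and fin2: "finite {q. singular_point M2 f2 q}"
  shows "C_count (prod_manifold M1 M2) k f =
    (\<Sum>i = 0..int (mdim M1). C_count M1 i f1 * C_count M2 (k - i) f2)"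
proof -
  define A where "A i = {p. singular_point M1 f1 p \<and> int (Morse_index M1 f1 p) = i}" for i
  define B where "B i = {q. singular_point M2 f2 q \<and> int (Morse_index M2 f2 q) = i}" for i
  have finA: "finite (A i)" and finB: "finite (B i)" for i
    using fin1 fin2 by (auto simp: A_def B_def)
  have "int (Morse_index M1 f1 p) \<in> {0..int (mdim M1)}" if "singular_point M1 f1 p" for p
    using Morse_index_le_dim[OF M1 f1 that] by simp
  then have "{z. singular_point (prod_manifold M1 M2) f z \<and>
      int (Morse_index (prod_manifold M1 M2) f z) = k} = (\<Union>i\<in>{0..int (mdim M1)}. A i \<times> B (k - i))"
    by (auto simp: singular_point_iff Morse_index_add A_def B_def)
  then have "C_count (prod_manifold M1 M2) k f = int (card (\<Union>i\<in>{0..int (mdim M1)}. A i \<times> B (k - i)))"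
    by (simp only: C_count_def)
  also have "card (\<Union>i\<in>{0..int (mdim M1)}. A i \<times> B (k - i)) =
      (\<Sum>i = 0..int (mdim M1). card (A i \<times> B (k - i)))"
    using finA finB by (intro card_UN_disjoint) (auto simp: A_def)
  finally show ?thesis
    by (simp add: card_cartesian_product C_count_def A_def B_def)
qed

theorem theorem3:
  fixes m1 m2 :: nat and j :: int
    and M1 :: "('a, 'e::euclidean_space) manifold" and f1 :: "'a \<Rightarrow> real"
    and M2 :: "('b, 'f::euclidean_space) manifold" and f2 :: "'b \<Rightarrow> real"
    and f :: "'a \<times> 'b \<Rightarrow> real"
  assumes "0 < m1" and "0 < m2" and "m1 \<le> m2"
    and "closed_manifold M1" and "mdim M1 = m1" and "Morse_function M1 f1"
    and "closed_manifold M2" and "mdim M2 = m2" and "Morse_function M2 f2"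
    and "diagonal_Morse_function M1 f1 M2 f2 f"
    and "0 \<le> j" and "j < \<lfloor>real m1\<rfloor>"
  shows "\<phi>_diff (prod_manifold M1 M2) (int m1 + int m2 - j) f =
    (\<Sum>j1 = 0..j. C_count M1 (int m1 - j + j1) f1 * C_count M2 (int m2 - j1) f2) -
    (\<Sum>j1 = 0..j. C_count M1 j1 f1 * C_count M2 (j - j1) f2)"
proof -
  have M1: "smooth_manifold M1" and M2: "smooth_manifold M2"
    using assms(4,7) by (auto simp: closed_manifold_def)
  obtain T where T: "affine_transformation T" "diagonally_oriented T"
    and f: "Morse_function (prod_manifold M1 M2) f"
    and fT: "\<And>p. p \<in> topspace (mtop (prod_manifold M1 M2)) \<Longrightarrow>
      f p = diagonal_projection (T (map_prod f1 f2 p))"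
    using assms(10) by (auto simp: diagonal_Morse_function_def)
  obtain a b c where ab: "0 < a" "0 < b"
    and abc: "\<And>x y. diagonal_projection (T (x, y)) = a * x + b * y + c"
    using diagonal_projection_affine[OF T] by blast
  interpret weighted_sum_on_product M1 f1 M2 f2 f a b c
    using M1 M2 assms(6,9) f ab by unfold_locales (auto simp: fT abc prod_manifold_def)
  have conv: "C_count (prod_manifold M1 M2) k f =
      (\<Sum>i = 0..int m1. C_count M1 i f1 * C_count M2 (k - i) f2)" for k
    using C_count_convolution finite_singular_points assms(4-9) by metis
  have z2: "C_count M2 i f2 = 0" if "i < 0 \<or> int m2 < i" for i
    using C_count_eq_0[OF M2 assms(9)] that assms(8) by simp
  have j: "0 \<le> j" "j < int m1"
    using assms(11,12) by auto
  \<comment> \<open>For \<open>i < m1 - j\<close> the index left for \<open>f2\<close> exceeds \<open>m2\<close>.\<close>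
  have "C_count (prod_manifold M1 M2) (int m1 + int m2 - j) f =
      (\<Sum>i = int m1 - j..int m1. C_count M1 i f1 * C_count M2 (int m1 + int m2 - j - i) f2)"
    unfolding conv using j by (intro sum.mono_neutral_right) (auto simp: z2)
  also have "\<dots> = (\<Sum>j1 = 0..j. C_count M1 (int m1 - j + j1) f1 * C_count M2 (int m2 - j1) f2)"
    by (rule sum.reindex_bij_witness[of _ "\<lambda>j1. int m1 - j + j1" "\<lambda>i. i - (int m1 - j)"])
       (auto simp: algebra_simps)
  finally have top: "C_count (prod_manifold M1 M2) (int m1 + int m2 - j) f = \<dots>" .
  \<comment> \<open>For \<open>i > j\<close> the index left for \<open>f2\<close> is negative.\<close>
  have "C_count (prod_manifold M1 M2) j f =
      (\<Sum>j1 = 0..j. C_count M1 j1 f1 * C_count M2 (j - j1) f2)"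
    unfolding conv using j by (intro sum.mono_neutral_right) (auto simp: z2)
  moreover have "int (mdim (prod_manifold M1 M2)) - (int m1 + int m2 - j) = j"
    using assms(5,8) by (simp add: mdim_def)
  ultimately show ?thesis
    using top by (simp only: \<phi>_diff_def)
qed

end
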